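(* Let $m,i,j$ be positive integers and let $q=2^m$, $Q_1=2^i$, $Q_2=2^j$. The polynomial $$f_A(x)=x^{q(Q_1+Q_2)+1}+x^{q(Q_1+1)+Q_2}+x^{q(Q_2+1)+Q_1}+x^{Q_1+Q_2+q}+x^{Q_1+Q_2+1}\in\mathbb{F}_{q^2}[x]$$ is a permutation of $\mathbb{F}_{q^2}$ if and only if one of the following holds: (i) $m$ is odd, $ij\equiv 1\pmod 2$, and $\gcd(Q_1+Q_2+1,q-1)=1$; moreover, in this case $f_A$ is linear equivalent to the function $(u,v)\mapsto(u^{Q_1+Q_2+1},v^{Q_1+Q_2+1})$ from $\mathbb{F}_q^2$ to $\mathbb{F}_q^2$; (ii) $m$ is even and $\gcd(Q_1+Q_2+1,q-1)=\gcd(Q_1+Q_2+1-2r_A,q+1)=1$, where the integer $r_A$ is defined by: $r_A=0$ if $i\equiv j\equiv 1\pmod 2$; $r_A=1$ if $i\equiv j\equiv 0\pmod 2$; $r_A=Q_1$ if $i\equiv 0$, $j\equiv 1\pmod 2$ and $Q_1\le Q_2$; $r_A=Q_2+1$ if $i\equiv 0$, $j\equiv1\pmod 2$ and $Q_1>Q_2$; $r_A=Q_1+1$ if $i\equiv 1$, $j\equiv 0\pmod 2$ and $Q_1<Q_2$; $r_A=Q_2$ if $i\equiv 1$, $j\equiv 0\pmod 2$ and $Q_1\ge Q_2$. Moreover, in this case $f_A$ is linear equivalent to the function $x\mapsto x^{Q_1+Q_2+1+r_A(q-1)}$ on $\mathbb{F}_{q^2}$.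
   Context: A map is called linear here if it is additive (i.e. $\mathbb{F}_2$-linear). A function $F$ on $\mathbb{F}_{q^2}$ is linear equivalent to a function $P:X\to X$ (where $X=\mathbb{F}_{q^2}$ or $X=\mathbb{F}_q^2$) if $F=L_1\circ P\circ L_2$ for some additive bijections $L_2:\mathbb{F}_{q^2}\to X$ and $L_1:X\to\mathbb{F}_{q^2}$. *)

theory Defs
  imports
    "HOL-Computational_Algebra.Computational_Algebra"
    "HOL-Library.Product_Plus"
    "HOL-Library.Cardinality"
begin

text \<open>
  The field with \<open>q\<^sup>2\<close> elements is a type of class \<open>finite_field\<close> with \<open>q\<^sup>2\<close> elements.
  The field with \<open>q\<close> elements is its subfield of order \<open>q\<close>, i.e. the fixed points of
  \<open>x \<mapsto> x ^ q\<close>; the lemmas below confirm that this is a subfield with \<open>q\<close> elements.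
\<close>

definition Fq :: "nat \<Rightarrow> 'a::finite_field set" where
  "Fq q = {x. x ^ q = x}"

text \<open>
  The space \<open>X\<close> is a set rather than a type, since it may be \<open>Fq q \<times> Fq q\<close>.
\<close>

definition additive_bij_betw ::
    "('b::ab_group_add \<Rightarrow> 'c::ab_group_add) \<Rightarrow> 'b set \<Rightarrow> 'c set \<Rightarrow> bool" where
  "additive_bij_betw L A B \<longleftrightarrow>
     bij_betw L A B \<and> (\<forall>x\<in>A. \<forall>y\<in>A. L (x + y) = L x + L y)"

definition linear_equivalent ::
    "('a::finite_field \<Rightarrow> 'a) \<Rightarrow> 'b::ab_group_add set \<Rightarrow> ('b \<Rightarrow> 'b) \<Rightarrow> bool" where
  "linear_equivalent F X P \<longleftrightarrow> P ` X \<subseteq> X \<and>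
     (\<exists>L1 L2. additive_bij_betw L2 UNIV X \<and> additive_bij_betw L1 X UNIV \<and>
              F = L1 \<circ> P \<circ> L2)"

definition f_A :: "nat \<Rightarrow> nat \<Rightarrow> nat \<Rightarrow> 'a::finite_field poly" where
  "f_A q Q1 Q2 =
     monom 1 (q * (Q1 + Q2) + 1) + monom 1 (q * (Q1 + 1) + Q2) +
     monom 1 (q * (Q2 + 1) + Q1) + monom 1 (Q1 + Q2 + q) + monom 1 (Q1 + Q2 + 1)"

definition r_A :: "nat \<Rightarrow> nat \<Rightarrow> nat" where
  "r_A i j = (let Q1 = 2 ^ i; Q2 = 2 ^ j in
     if odd i \<and> odd j then 0
     else if even i \<and> even j then 1
     else if even i \<and> odd j then (if Q1 \<le> Q2 then Q1 else Q2 + 1)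
     else (if Q1 < Q2 then Q1 + 1 else Q2))"

context
  fixes m q :: nat
  assumes m: "0 < m" and q: "q = 2 ^ m" and card: "CARD('a::finite_field) = q ^ 2"
begin

lemma CHAR_eq_2: "CHAR('a) = 2"
proof -
  have "even (q ^ 2)" using m q by simp
  then have "(- 1 :: 'a) = 1"
    using finite_field_power_card_eq_same[of "- 1 :: 'a"] card by simp
  then have "of_nat 2 = (0 :: 'a)"
    by (metis add.right_inverse one_add_one of_nat_numeral)
  then have "CHAR('a) dvd 2" by (simp only: of_nat_eq_0_iff_char_dvd)
  moreover have "prime CHAR('a)"
    by (rule prime_CHAR_semidom) (rule finite_imp_CHAR_pos, rule finite)
  ultimately show ?thesis
    by (simp add: primes_dvd_imp_eq)
qed

lemma power_q_add: "(x + y) ^ q = x ^ q + (y :: 'a) ^ q"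
  by (rule freshmans_dream') (simp_all add: CHAR_eq_2 q)

lemma Fq_subfield:
  "0 \<in> (Fq q :: 'a set)" "1 \<in> (Fq q :: 'a set)"
  "x \<in> Fq q \<Longrightarrow> y \<in> Fq q \<Longrightarrow> x + y \<in> (Fq q :: 'a set)"
  "x \<in> Fq q \<Longrightarrow> - x \<in> (Fq q :: 'a set)"
  "x \<in> Fq q \<Longrightarrow> y \<in> Fq q \<Longrightarrow> x * y \<in> (Fq q :: 'a set)"
  "x \<in> Fq q \<Longrightarrow> inverse x \<in> (Fq q :: 'a set)"
proof -
  have "0 < q" using q by simp
  then show
    "0 \<in> (Fq q :: 'a set)" "1 \<in> (Fq q :: 'a set)"
    "x \<in> Fq q \<Longrightarrow> y \<in> Fq q \<Longrightarrow> x + y \<in> (Fq q :: 'a set)"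
    "x \<in> Fq q \<Longrightarrow> - x \<in> (Fq q :: 'a set)"
    "x \<in> Fq q \<Longrightarrow> y \<in> Fq q \<Longrightarrow> x * y \<in> (Fq q :: 'a set)"
    "x \<in> Fq q \<Longrightarrow> inverse x \<in> (Fq q :: 'a set)"
    by (simp_all add: Fq_def power_q_add power_mult_distrib power_inverse
        uminus_CHAR_2[OF CHAR_eq_2])
qed

lemma card_Fq: "card (Fq q :: 'a set) = q"
proof (rule antisym)
  define p :: "'a poly" where "p = monom 1 q - monom 1 1"
  have q2: "2 \<le> q" using m q by (cases m) auto
  have c: "coeff p q = 1" using q2 by (simp add: p_def)
  have "p \<noteq> 0" using c by auto
  moreover have "degree p \<le> q"
    unfolding p_def by (intro degree_diff_le order.trans[OF degree_monom_le]) (use q2 in auto)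
  moreover have "{x. poly p x = 0} = Fq q"
    by (auto simp: p_def Fq_def poly_monom)
  ultimately show "card (Fq q :: 'a set) \<le> q"
    using card_poly_roots_bound[of p] by simp
next
  define T :: "'a \<Rightarrow> 'a" where "T x = x ^ q + x" for x
  have neg: "- x = x" for x :: 'a by (rule uminus_CHAR_2[OF CHAR_eq_2])
  have frob: "(x ^ q) ^ q = x" for x :: 'a
    using finite_field_power_card_eq_same[of x] card
    by (simp add: power_mult power2_eq_square)
  have T: "T x \<in> Fq q" for x
    by (simp add: T_def Fq_def power_q_add frob add.commute)
  have fib: "card {x. T x = y} \<le> card (Fq q :: 'a set)" for y
  proof (cases "\<exists>x0. T x0 = y")
    case True
    then obtain x0 where x0: "T x0 = y" by blast
    have "x + x0 \<in> Fq q" if "T x = y" for x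
    proof -
      have "(x ^ q + x0 ^ q) + (x + x0) = 0"
        using that x0 neg unfolding T_def
        by (metis add.left_inverse add.assoc add.left_commute)
      then show ?thesis
        by (metis (mono_tags, lifting) CollectI Fq_def neg add_eq_0_iff power_q_add)
    qed
    then have "(\<lambda>x. x + x0) ` {x. T x = y} \<subseteq> Fq q" by auto
    then show ?thesis
      by (metis (no_types, lifting) card_inj_on_le finite inj_on_def add_right_cancel)
  qed auto
  have "UNIV = (\<Union>y\<in>Fq q. {x. T x = y})" using T by auto
  then have "CARD('a) \<le> (\<Sum>y\<in>(Fq q :: 'a set). card {x. T x = y})"
    by (metis card_UN_le finite)
  also have "\<dots> \<le> card (Fq q :: 'a set) * card (Fq q :: 'a set)"
    using sum_bounded_above[of "Fq q :: 'a set", OF fib] by simp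
  finally show "q \<le> card (Fq q :: 'a set)"
    unfolding card by (simp add: power2_eq_square power2_nat_le_eq_le flip: power2_eq_square)
qed

end

end

theory Submission
  imports Defs
begin

text \<open>
  Let \<open>w\<close> be a primitive cube root of unity, and put \<open>z = x + w x\<^sup>q\<close> and \<open>z' = x + w\<^sup>2 x\<^sup>q\<close>.
  As a trilinear form in \<open>x\<close>, \<open>x ^ Q1\<close>, \<open>x ^ Q2\<close> and their \<open>q\<close>-th powers, the polynomial has rank two
  over the field with four elements: it equals \<open>w A + w\<^sup>2 B\<close>, where \<open>A = z ^ a * z' ^ b\<close>,
  \<open>B = z' ^ a * z ^ b\<close> and \<open>a + b = Q1 + Q2 + 1\<close>.  If \<open>m\<close> is even, then \<open>z' = w\<^sup>2 z\<^sup>q\<close>, and everything is an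
  additive bijection applied to the monomial \<open>z ^ (a + q b)\<close>.  If \<open>m\<close> is odd, then \<open>z\<close> and \<open>z'\<close> are
  independent coordinates on two lines over \<open>Fq q\<close>, and the polynomial becomes
  \<open>(u, v) \<mapsto> (u ^ a * v ^ b, u ^ b * v ^ a)\<close>, which collapses the axes unless \<open>b = 0\<close>.
\<close>

section \<open>Power maps\<close>

text \<open>Root counting: \<open>x ^ (n div p) = 1\<close> has at most \<open>n div p\<close>
  solutions, fewer than the nonzero elements of \<open>S\<close>. Any other nonzero \<open>x\<close>
  yields the root \<open>x ^ (n div p)\<close>. The order \<open>p\<close> may be composite.\<close>

lemma ex_nontrivial_root_of_unity:
  fixes S :: "'a::idom set"
  assumes S: "finite S" "card S = Suc n" and unit: "\<And>x. x \<in> S \<Longrightarrow> x \<noteq> 0 \<Longrightarrow> x ^ n = 1"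
    and mult: "\<And>x k. x \<in> S \<Longrightarrow> x ^ k \<in> S" and p: "p dvd n" "1 < p" and n: "0 < n"
  shows "\<exists>y\<in>S. y \<noteq> 1 \<and> y ^ p = 1"
proof -
  obtain k where k: "n = p * k" using p by blast
  have k0: "0 < k" "k < n" using k p n by (auto intro: Nat.gr0I)
  define P :: "'a poly" where "P = monom 1 k - 1"
  have "coeff P k = 1" using k0 by (simp add: P_def)
  then have P0: "P \<noteq> 0" by auto
  have deg: "degree P \<le> k" unfolding P_def
    by (intro degree_diff_le degree_monom_le) simp
  have "card {x. poly P x = 0} \<le> k"
    using card_poly_roots_bound[OF P0] deg by linarith
  moreover have "finite {x. poly P x = 0}" by (rule poly_roots_finite[OF P0])
  moreover have "n \<le> card (S - {0})" using S by (cases "0 \<in> S") auto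
  ultimately have "\<not> S - {0} \<subseteq> {x. poly P x = 0}"
    using k0 card_mono[of "{x. poly P x = 0}" "S - {0}"] by linarith
  then obtain x where x: "x \<in> S" "x \<noteq> 0" "x ^ k \<noteq> 1"
    by (auto simp: P_def poly_monom)
  have "(x ^ k) ^ p = 1" using unit[OF x(1,2)] by (simp add: k mult.commute flip: power_mult)
  then show ?thesis using x mult by blast
qed

text \<open>A common factor of \<open>e\<close> and \<open>n\<close> gives a nontrivial root of
  unity that collides with 1; otherwise Bezout supplies an inverse exponent. The set
  \<open>S\<close> allows both the whole field and \<open>Fq q\<close>.\<close>

lemma inj_on_power_iff_coprime:
  fixes S :: "'a::field set"
  assumes S: "finite S" "card S = Suc n" and unit: "\<And>x. x \<in> S \<Longrightarrow> x \<noteq> 0 \<Longrightarrow> x ^ n = 1"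
    and mult: "\<And>x k. x \<in> S \<Longrightarrow> x ^ k \<in> S" and n: "0 < n" and e: "0 < e" and "1 \<in> S"
  shows "inj_on (\<lambda>x. x ^ e) S \<longleftrightarrow> coprime e n"
proof
  assume inj: "inj_on (\<lambda>x. x ^ e) S"
  show "coprime e n"
  proof (rule ccontr)
    assume "\<not> coprime e n"
    then have "gcd e n \<noteq> 1" by (simp add: coprime_iff_gcd_eq_1)
    moreover have "gcd e n \<noteq> 0" using e by simp
    ultimately have "1 < gcd e n" by linarith
    then obtain y where y: "y \<in> S" "y \<noteq> 1" "y ^ gcd e n = 1"
      using ex_nontrivial_root_of_unity[OF S unit mult _ _ n, of "gcd e n"] by auto
    obtain k where "e = gcd e n * k" using gcd_dvd1 by (rule dvdE)
    then have "y ^ e = (y ^ gcd e n) ^ k" by (metis power_mult)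
    then have "y ^ e = 1" by (simp add: y)
    then have "y ^ e = 1 ^ e" by simp
    with inj y \<open>1 \<in> S\<close> show False by (blast dest: inj_onD)
  qed
next
  assume "coprime e n"
  then obtain a b where ab: "a * e = b * n + 1"
    using bezout_nat[of e n] e by (auto simp: mult.commute)
  have inverse: "(x ^ e) ^ a = x" if "x \<in> S" for x
  proof (cases "x = 0")
    case True
    have "0 < a" using ab by (auto intro: Nat.gr0I)
    with True e show ?thesis by simp
  next
    case False
    have "(x ^ e) ^ a = x ^ (b * n + 1)" unfolding ab[symmetric] by (simp add: mult.commute flip: power_mult)
    also have "\<dots> = (x ^ n) ^ b * x" by (simp add: power_add mult.commute flip: power_mult)
    finally show ?thesis using unit[OF that False] by simp
  qed
  show "inj_on (\<lambda>x. x ^ e) S" using inverse by (intro inj_on_inverseI[of _ "\<lambda>y. y ^ a"])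
qed

lemma bij_iff_inj_on_of_factorization:
  fixes F :: "'a::finite \<Rightarrow> 'a"
  assumes "bij_betw L2 UNIV X" "bij_betw L1 X UNIV" "P ` X \<subseteq> X" "F = L1 \<circ> P \<circ> L2"
  shows "bij F \<longleftrightarrow> inj_on P X"
proof -
  have "bij F \<longleftrightarrow> inj F" using finite_UNIV_inj_surj[of F] by (auto simp: bij_def)
  also have "\<dots> \<longleftrightarrow> inj_on P X"
  proof
    assume "inj F"
    show "inj_on P X"
    proof (rule inj_onI)
      fix x y assume xy: "x \<in> X" "y \<in> X" "P x = P y"
      then obtain a b where "x = L2 a" "y = L2 b"
        using assms(1) by (metis bij_betw_imp_surj_on imageE)
      with xy have "F a = F b" by (simp add: assms(4))
      with \<open>inj F\<close> \<open>x = L2 a\<close> \<open>y = L2 b\<close> show "x = y" by (simp add: inj_eq)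
    qed
  next
    assume "inj_on P X"
    then have "inj_on (L1 \<circ> P) X" using assms(2,3)
      by (metis bij_betw_imp_inj_on comp_inj_on inj_on_subset subset_UNIV)
    then show "inj F" using assms(1,4)
      by (metis bij_betw_imp_inj_on bij_betw_imp_surj_on comp_inj_on)
  qed
  finally show ?thesis .
qed

lemma linear_equivalent_bij_iff:
  "linear_equivalent F X P \<Longrightarrow> bij F \<longleftrightarrow> inj_on P X"
  unfolding linear_equivalent_def additive_bij_betw_def
  using bij_iff_inj_on_of_factorization by metis

section \<open>Diagonalization of the polynomial\<close>

lemma two_power_mod_3: "(2::nat) ^ k mod 3 = (if even k then 1 else 2)"
proof (induction k)
  case (Suc k)
  have "(2::nat) ^ Suc k mod 3 = (2 * (2 ^ k mod 3)) mod 3" by (simp add: mod_mult_right_eq)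
  then show ?case using Suc by simp
qed simp

text \<open>
  For odd \<open>k\<close>, raising to the power \<open>2 ^ k\<close> exchanges \<open>w\<close> and \<open>w\<^sup>2\<close>.  Hence
  \<open>x ^ (2 ^ k) + w\<^sup>2 x ^ (q 2 ^ k)\<close> is a power of \<open>z\<close> for odd \<open>k\<close> and of \<open>z'\<close> for even \<open>k\<close>;
  the following exponents collect these factors.
\<close>

definition exp_z :: "nat \<Rightarrow> nat \<Rightarrow> nat" where
  "exp_z i j = 1 + (if odd i then 2 ^ i else 0) + (if odd j then 2 ^ j else 0)"

definition exp_z' :: "nat \<Rightarrow> nat \<Rightarrow> nat" where
  "exp_z' i j = (if even i then 2 ^ i else 0) + (if even j then 2 ^ j else 0)"

lemma exp_z_add_exp_z': "exp_z i j + exp_z' i j = 2 ^ i + 2 ^ j + 1"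
  by (simp add: exp_z_def exp_z'_def)

text \<open>Each of \<open>2 ^ i\<close> and \<open>2 ^ j\<close> contributes 2 modulo 3, either
  directly or doubled, so the total is 1 + 2 + 2. This congruence aligns the powers of
  \<open>w\<close> later.\<close>

lemma exp_z_mod_3: "(exp_z i j + 2 * exp_z' i j) mod 3 = 2"
  using two_power_mod_3[of i] two_power_mod_3[of j]
  by (auto simp: exp_z_def exp_z'_def split: if_splits) presburger+

text \<open>The case distinction in \<open>r_A\<close> picks the smaller of the two exponents. Only
  membership matters below, since the two choices lead to monomials conjugate under
  \<open>x ^ q\<close>.\<close>

lemma r_A_cases: "r_A i j = exp_z i j \<or> r_A i j = exp_z' i j"
  by (auto simp: r_A_def exp_z_def exp_z'_def Let_def)

text \<open>Rewrite rules that bring polynomials in \<open>w\<close> to the form a + b w in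
  characteristic 2; the nested variants serve rewriting modulo associativity and
  commutativity.\<close>

lemma char2_omega_simps:
  fixes w :: "'a::idom"
  assumes w: "w * w + w + 1 = 0" and two: "(1::'a) + 1 = 0"
  shows "x + x = 0" "x + (x + y) = y" "w * w = w + 1" "w * (w * y) = w * y + y"
    "w ^ 2 = w + 1"
proof -
  show xx: "x + x = 0" for x :: 'a using two by (metis distrib_left mult_1_right mult_zero_right)
  then show "x + (x + y) = y" by (simp flip: add.assoc)
  show ww: "w * w = w + 1" using w xx by (metis add.assoc add_right_cancel)
  then show "w ^ 2 = w + 1" by (simp add: power2_eq_square)
  show "w * (w * y) = w * y + y" using ww by (simp add: distrib_right flip: mult.assoc)
qed

text \<open>On the right, a monomial with \<open>Y\<close> in a of the slots 1, 2 and in b of the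
  slot 0 has coefficient w^n + w^(2n), where n = 1 + 2a + b. This is 0 if 3 divides n and 1
  otherwise, which selects the five terms on the left.\<close>

lemma trilinear_identity:
  fixes w X0 X1 X2 Y0 Y1 Y2 :: "'a::idom"
  assumes "w * w + w + 1 = 0" "(1::'a) + 1 = 0"
  shows "Y1 * Y2 * X0 + Y1 * Y0 * X2 + Y2 * Y0 * X1 + X1 * X2 * Y0 + X1 * X2 * X0 =
    w * ((X1 + w^2 * Y1) * (X2 + w^2 * Y2) * (X0 + w * Y0)) +
    w^2 * ((X1 + w * Y1) * (X2 + w * Y2) * (X0 + w^2 * Y0))"
  by (simp add: char2_omega_simps[OF assms] algebra_simps)

context
  fixes m q :: nat and w :: "'a::finite_field"
  assumes m: "0 < m" and q: "q = 2 ^ m" and card: "CARD('a) = q ^ 2"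
    and w: "w * w + w + 1 = 0"
begin

private lemma char2: "(1::'a) + 1 = 0"
  using uminus_CHAR_2[OF CHAR_eq_2[OF m q card], of 1] by (metis add.right_inverse)

private lemma neg: "- x = (x :: 'a)"
  by (rule uminus_CHAR_2[OF CHAR_eq_2[OF m q card]])

private lemma pq_add: "(x + y) ^ q = x ^ q + (y :: 'a) ^ q"
  by (rule power_q_add[OF m q card])

private lemma pow2_add: "(x + y) ^ (2 ^ k) = x ^ (2 ^ k) + (y :: 'a) ^ (2 ^ k)"
  by (rule freshmans_dream') (simp_all add: CHAR_eq_2[OF m q card])

private lemma frob: "(x ^ q) ^ q = (x :: 'a)"
  using finite_field_power_card_eq_same[of x] card by (simp add: power_mult power2_eq_square)

private lemmas omega_simps = char2_omega_simps[OF w char2]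

private lemma w3: "w ^ 3 = 1"
proof -
  show ?thesis by (simp add: power3_eq_cube omega_simps algebra_simps)
qed

private lemma w_power_mod: "w ^ n = w ^ (n mod 3)"
  by (metis mult_div_mod_eq power_add power_mult w3 power_one mult_1)

private lemma w_power_cong: "a mod 3 = b mod 3 \<Longrightarrow> w ^ a = w ^ b"
  by (metis w_power_mod)

private lemma w_ne_0: "w \<noteq> 0" using w by auto

private lemma poly_f_A:
  fixes x i j
  defines "z \<equiv> x + w * x ^ q" and "z' \<equiv> x + w ^ 2 * x ^ q"
  shows "poly (f_A q (2 ^ i) (2 ^ j)) x =
    w * (z ^ exp_z i j * z' ^ exp_z' i j) + w ^ 2 * (z' ^ exp_z i j * z ^ exp_z' i j)"
proof -
  define y where "y = x ^ q"
  have odd: "z ^ 2 ^ k = x ^ 2 ^ k + w ^ 2 * y ^ 2 ^ k" "z' ^ 2 ^ k = x ^ 2 ^ k + w * y ^ 2 ^ k"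
    if "odd k" for k
  proof -
    have "w ^ 2 ^ k = w ^ 2" "(w ^ 2) ^ 2 ^ k = w ^ 1" unfolding power_mult[symmetric]
      by (rule w_power_cong, use two_power_mod_3[of k] that in simp; presburger)+
    then show "z ^ 2 ^ k = x ^ 2 ^ k + w ^ 2 * y ^ 2 ^ k" "z' ^ 2 ^ k = x ^ 2 ^ k + w * y ^ 2 ^ k"
      by (simp_all add: z_def z'_def pow2_add power_mult_distrib flip: y_def)
  qed
  have even: "z ^ 2 ^ k = x ^ 2 ^ k + w * y ^ 2 ^ k" "z' ^ 2 ^ k = x ^ 2 ^ k + w ^ 2 * y ^ 2 ^ k"
    if "even k" for k
  proof -
    have "w ^ 2 ^ k = w ^ 1" "(w ^ 2) ^ 2 ^ k = w ^ 2" unfolding power_mult[symmetric]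
      by (rule w_power_cong, use two_power_mod_3[of k] that in simp; presburger)+
    then show "z ^ 2 ^ k = x ^ 2 ^ k + w * y ^ 2 ^ k" "z' ^ 2 ^ k = x ^ 2 ^ k + w ^ 2 * y ^ 2 ^ k"
      by (simp_all add: z_def z'_def pow2_add power_mult_distrib flip: y_def)
  qed
  \<comment> \<open>The lone factor \<open>s\<close> comes from \<open>x\<close> itself and is the
    summand 1 in \<open>exp_z\<close>.\<close>
  have factor: "s ^ exp_z i j * t ^ exp_z' i j = F i * F j * s"
    if "\<And>k. F k = (if odd k then s ^ 2 ^ k else t ^ 2 ^ k)" for s t :: 'a and F
    by (simp add: exp_z_def exp_z'_def power_add that mult_ac)
  have A: "z ^ exp_z i j * z' ^ exp_z' i j =
      (x ^ 2 ^ i + w ^ 2 * y ^ 2 ^ i) * (x ^ 2 ^ j + w ^ 2 * y ^ 2 ^ j) * (x + w * y)"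
    using factor[of "\<lambda>k. x ^ 2 ^ k + w ^ 2 * y ^ 2 ^ k" z z'] by (simp add: odd even) (simp add: z_def y_def)
  have B: "z' ^ exp_z i j * z ^ exp_z' i j =
      (x ^ 2 ^ i + w * y ^ 2 ^ i) * (x ^ 2 ^ j + w * y ^ 2 ^ j) * (x + w ^ 2 * y)"
    using factor[of "\<lambda>k. x ^ 2 ^ k + w * y ^ 2 ^ k" z' z] by (simp add: odd even) (simp add: z'_def y_def)
  have "poly (f_A q (2 ^ i) (2 ^ j)) x =
      y ^ 2 ^ i * y ^ 2 ^ j * x + y ^ 2 ^ i * y * x ^ 2 ^ j + y ^ 2 ^ j * y * x ^ 2 ^ i +
      x ^ 2 ^ i * x ^ 2 ^ j * y + x ^ 2 ^ i * x ^ 2 ^ j * x"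
    by (simp add: f_A_def poly_monom y_def power_add distrib_left power_mult mult_ac)
  also have "\<dots> = w * ((x ^ 2 ^ i + w ^ 2 * y ^ 2 ^ i) * (x ^ 2 ^ j + w ^ 2 * y ^ 2 ^ j) * (x + w * y))
      + w ^ 2 * ((x ^ 2 ^ i + w * y ^ 2 ^ i) * (x ^ 2 ^ j + w * y ^ 2 ^ j) * (x + w ^ 2 * y))"
    by (rule trilinear_identity[OF w char2])
  finally show ?thesis unfolding A B .
qed

subsection \<open>Even \<open>m\<close>\<close>

text \<open>For even \<open>m\<close> the cube roots of unity lie in \<open>Fq q\<close>, so
  \<open>b ^ q = b\<close>, and the kernel can be computed from its defining equation and the
  conjugate one.\<close>

private lemma additive_bij_even:
  assumes "even m" "b = w \<or> b = w ^ 2" "a \<noteq> 0"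
  shows "additive_bij_betw (\<lambda>x. a * (x + b * x ^ q)) UNIV (UNIV :: 'a set)"
proof -
  have wq: "w ^ q = w ^ 1"
    by (rule w_power_cong) (simp add: q two_power_mod_3 assms)
  have bq: "b ^ q = b" using assms(2) wq by (metis power_commutes power_mult mult.commute power_one_right)
  have b: "b * b + b + 1 = 0" using assms(2)
  proof
    assume "b = w ^ 2"
    then show ?thesis by (simp add: omega_simps algebra_simps)
  qed (use w in simp)
  have add: "a * (x + y + b * (x + y) ^ q) = a * (x + b * x ^ q) + a * (y + b * y ^ q)" for x y
    by (simp add: pq_add algebra_simps)
  have "x = y" if "a * (x + b * x ^ q) = a * (y + b * y ^ q)" for x y
  proof -
    define t where "t = x + y"
    have "(x + b * x ^ q) = (y + b * y ^ q)" using that \<open>a \<noteq> 0\<close> by simp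
    moreover have "t + b * t ^ q = (x + b * x ^ q) + (y + b * y ^ q)"
      by (simp add: t_def pq_add algebra_simps)
    ultimately have 1: "t + b * t ^ q = 0" using neg by (metis add.right_inverse)
    then have "(t + b * t ^ q) ^ q = 0" using q by simp
    then have 2: "t ^ q + b * t = 0" by (simp add: pq_add power_mult_distrib bq frob)
    \<comment> \<open>Adding \<open>b\<close> times the conjugate equation eliminates
      \<open>t ^ q\<close> and leaves (b^2 + 1) t, which is b t up to sign.\<close>
    have "(t + b * t ^ q) + b * (t ^ q + b * t) = (b * b + b + 1) * t + (b * t ^ q + b * t ^ q) - b * t"
      by (simp add: algebra_simps)
    then have "b * t = 0" using 1 2 b omega_simps(1) by simp
    moreover have "b \<noteq> 0" using b by auto
    ultimately have "t = 0" by simp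
    then show "x = y" unfolding t_def by (metis neg add_eq_0_iff)
  qed
  then have "inj (\<lambda>x. a * (x + b * x ^ q))" by (rule injI)
  then show ?thesis unfolding additive_bij_betw_def bij_betw_def using add
    by (auto simp: finite_UNIV_inj_surj)
qed

text \<open>The two monomials in \<open>z\<close> have exponents
  \<open>\<alpha> + q * \<beta>\<close> and \<open>q * \<alpha> + \<beta>\<close>, and each is the
  \<open>q\<close>-th power of the other. Hence the polynomial is an additive map of either
  one.\<close>

lemma linear_equivalent_f_A_even:
  assumes "even m"
  shows "linear_equivalent (poly (f_A q (2 ^ i) (2 ^ j) :: 'a poly)) (UNIV :: 'a set)
    (\<lambda>x. x ^ (2 ^ i + 2 ^ j + 1 + r_A i j * (q - 1)))"
proof -
  define \<alpha> \<beta> where "\<alpha> = exp_z i j" and "\<beta> = exp_z' i j"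
  define e where "e = 2 ^ i + 2 ^ j + 1 + r_A i j * (q - 1)"
  have wq: "w ^ q = w ^ 1"
    by (rule w_power_cong) (simp add: q two_power_mod_3 assms)
  have mod: "(\<alpha> + 2 * \<beta>) mod 3 = 2" unfolding \<alpha>_def \<beta>_def by (rule exp_z_mod_3)
  have q0: "q = Suc (q - 1)" using q by simp
  have f: "poly (f_A q (2 ^ i) (2 ^ j)) x =
      w ^ (2 * \<alpha>) * (z ^ (\<alpha> + q * \<beta>) + w ^ 2 * z ^ (q * \<alpha> + \<beta>))" if z: "z = x + w * x ^ q" for x z
  proof -
    have "z ^ q = x ^ q + w * x" by (simp add: z pq_add power_mult_distrib wq frob)
    then have z': "x + w ^ 2 * x ^ q = w ^ 2 * z ^ q"
      using w3 by (simp add: algebra_simps power2_eq_square power3_eq_cube)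
    have 1: "w ^ Suc (2 * \<beta>) = w ^ (2 * \<alpha>)"
      by (rule w_power_cong) (use mod in presburger)
    have "poly (f_A q (2 ^ i) (2 ^ j)) x = w * (z ^ \<alpha> * (w ^ 2 * z ^ q) ^ \<beta>) +
        w ^ 2 * ((w ^ 2 * z ^ q) ^ \<alpha> * z ^ \<beta>)"
      unfolding poly_f_A \<alpha>_def \<beta>_def z'[symmetric] unfolding z ..
    also have "\<dots> = w ^ Suc (2 * \<beta>) * z ^ (\<alpha> + q * \<beta>) + w ^ (2 * \<alpha>) * (w ^ 2 * z ^ (q * \<alpha> + \<beta>))"
      by (simp add: power_mult_distrib power_add mult_ac flip: power_mult)
    finally show ?thesis unfolding 1 by (simp add: distrib_left)
  qed
  have zq: "(z ^ (\<alpha> + q * \<beta>)) ^ q = z ^ (q * \<alpha> + \<beta>)" for z :: 'a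
  proof -
    have "(z ^ (\<alpha> + q * \<beta>)) ^ q = (z ^ q) ^ \<alpha> * ((z ^ q) ^ q) ^ \<beta>"
      by (simp add: power_add power_mult_distrib mult_ac flip: power_mult)
    then show ?thesis unfolding frob by (simp only: power_add power_mult)
  qed
  have qz: "(z ^ (q * \<alpha> + \<beta>)) ^ q = z ^ (\<alpha> + q * \<beta>)" for z :: 'a
    unfolding zq[symmetric] by (rule frob)
  have "\<exists>a b. a \<noteq> 0 \<and> (b = w \<or> b = w ^ 2) \<and> (\<forall>x. poly (f_A q (2 ^ i) (2 ^ j)) x =
      a * ((x + w * x ^ q) ^ e + b * ((x + w * x ^ q) ^ e) ^ q))"
    using r_A_cases[of i j]
  proof
    assume r: "r_A i j = exp_z i j"
    have "e = \<alpha> + \<beta> + \<alpha> * (q - 1)"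
      unfolding e_def r \<alpha>_def \<beta>_def exp_z_add_exp_z' ..
    then have e: "e = q * \<alpha> + \<beta>" by (subst q0) (simp add: mult.commute)
    \<comment> \<open>Pulling out \<open>w ^ 2\<close> lets the other monomial lead, which turns the
      inner coefficient from \<open>w ^ 2\<close> into \<open>w\<close>.\<close>
    have "w ^ (2 * \<alpha>) * (s + w ^ 2 * t) = w ^ (2 * \<alpha>) * w ^ 2 * (t + w * s)" for s t
      using w3 by (simp add: algebra_simps power2_eq_square power3_eq_cube)
    then show ?thesis using w_ne_0 unfolding f[OF refl] e qz
      by (intro exI[of _ "w ^ (2 * \<alpha>) * w ^ 2"] exI[of _ w]) auto
  next
    assume r: "r_A i j = exp_z' i j"
    have "e = \<alpha> + \<beta> + \<beta> * (q - 1)"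
      unfolding e_def r \<alpha>_def \<beta>_def exp_z_add_exp_z' ..
    then have e: "e = \<alpha> + q * \<beta>" by (subst q0) (simp add: mult.commute)
    show ?thesis using w_ne_0 unfolding f[OF refl] e zq
      by (intro exI[of _ "w ^ (2 * \<alpha>)"] exI[of _ "w ^ 2"]) auto
  qed
  then obtain a b where ab: "a \<noteq> 0" "b = w \<or> b = w ^ 2"
    and "\<And>x. poly (f_A q (2 ^ i) (2 ^ j)) x =
      a * ((x + w * x ^ q) ^ e + b * ((x + w * x ^ q) ^ e) ^ q)" by blast
  then have "poly (f_A q (2 ^ i) (2 ^ j)) =
      (\<lambda>x. a * (x + b * x ^ q)) \<circ> (\<lambda>x. x ^ e) \<circ> (\<lambda>x. x + w * x ^ q)" by auto
  moreover have "additive_bij_betw (\<lambda>x. a * (x + b * x ^ q)) UNIV (UNIV :: 'a set)"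
    by (rule additive_bij_even) (use assms ab in auto)
  moreover have "additive_bij_betw (\<lambda>x. x + w * x ^ q) UNIV (UNIV :: 'a set)"
    using additive_bij_even[of w 1] assms by simp
  ultimately show ?thesis
    unfolding linear_equivalent_def e_def[symmetric] by blast
qed

subsection \<open>Odd \<open>m\<close>\<close>

lemma linear_equivalent_f_A_odd:
  assumes "odd m"
  shows "linear_equivalent (poly (f_A q (2 ^ i) (2 ^ j) :: 'a poly)) (Fq q \<times> Fq q :: ('a \<times> 'a) set)
    (\<lambda>(u, v). (u ^ exp_z i j * v ^ exp_z' i j, u ^ exp_z' i j * v ^ exp_z i j))"
proof -
  define \<alpha> \<beta> where "\<alpha> = exp_z i j" and "\<beta> = exp_z' i j"
  \<comment> \<open>The coordinates are the traces to \<open>Fq q\<close> of \<open>w * x\<close>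
    and \<open>w ^ 2 * x\<close>; for odd \<open>m\<close> the map \<open>x ^ q\<close> exchanges
    \<open>w\<close> and \<open>w ^ 2\<close>. They are \<open>z\<close> and \<open>z'\<close> up to
    powers of \<open>w\<close>.\<close>
  define L where "L = (\<lambda>x. (w * x + w ^ 2 * x ^ q, w ^ 2 * x + w * x ^ q))"
  define M where "M = (\<lambda>(u, v). w * u + w ^ 2 * v)"
  \<comment> \<open>\<open>M\<close> inverts \<open>L\<close>, but the expansion of the polynomial
    attaches \<open>w ^ 2\<close> to the first coordinate and \<open>w\<close> to the second. Hence
    the outer map is \<open>M\<close> after a swap.\<close>
  define M' where "M' = (\<lambda>(u, v). w ^ 2 * u + w * v)"
  note Fq = Fq_subfield[OF m q card]
  have Fq_power: "x ^ k \<in> Fq q" if "x \<in> Fq q" for x :: 'a and k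
    using that by (induction k) (auto intro: Fq)
  have mod: "(\<alpha> + 2 * \<beta>) mod 3 = 2" unfolding \<alpha>_def \<beta>_def by (rule exp_z_mod_3)
  have wq: "w ^ q = w ^ 2"
    by (rule w_power_cong) (simp add: q two_power_mod_3 assms)
  have w2q: "(w ^ 2) ^ q = w"
    using wq frob[of w] by simp
  have L_Fq: "L x \<in> Fq q \<times> Fq q" for x
    by (simp add: L_def Fq_def pq_add power_mult_distrib wq w2q frob add.commute)
  have MofL: "M (L x) = x" for x
  proof -
    have "w * (w * x + w ^ 2 * y) + w ^ 2 * (w ^ 2 * x + w * y) = x" for y
      by (simp add: omega_simps algebra_simps)
    then show ?thesis by (simp add: M_def L_def)
  qed
  have LofM: "L (M p) = p" if "p \<in> Fq q \<times> Fq q" for p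
  proof -
    obtain u v where p: "p = (u, v)" by (cases p)
    have "(M p) ^ q = w ^ 2 * u + w * v"
      using that by (simp add: p M_def Fq_def pq_add power_mult_distrib wq w2q)
    moreover have "w * (w * u + w ^ 2 * v) + w ^ 2 * (w ^ 2 * u + w * v) = u"
      "w ^ 2 * (w * u + w ^ 2 * v) + w * (w ^ 2 * u + w * v) = v"
      by (simp_all add: omega_simps algebra_simps)
    ultimately show ?thesis by (simp add: L_def p M_def)
  qed
  have bijL: "bij_betw L UNIV (Fq q \<times> Fq q)"
    by (rule bij_betw_byWitness[of _ M]) (use L_Fq LofM MofL in blast)+
  have "bij_betw M (Fq q \<times> Fq q) UNIV"
    by (rule bij_betw_byWitness[of _ L]) (use L_Fq LofM MofL in blast)+
  moreover have "bij_betw prod.swap (Fq q \<times> Fq q) (Fq q \<times> Fq q :: ('a \<times> 'a) set)"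
    by (rule bij_betw_byWitness[of _ prod.swap]) auto
  ultimately have "bij_betw (M \<circ> prod.swap) (Fq q \<times> Fq q) UNIV"
    by (rule bij_betw_trans[rotated])
  also have "M \<circ> prod.swap = M'" by (auto simp: M_def M'_def)
  finally have L1: "additive_bij_betw M' (Fq q \<times> Fq q) UNIV"
    by (auto simp: additive_bij_betw_def M'_def algebra_simps)
  have L2: "additive_bij_betw L UNIV (Fq q \<times> Fq q)"
    using bijL by (auto simp: additive_bij_betw_def L_def pq_add algebra_simps)
  have "poly (f_A q (2 ^ i) (2 ^ j)) x =
      M' ((\<lambda>(u, v). (u ^ \<alpha> * v ^ \<beta>, u ^ \<beta> * v ^ \<alpha>)) (L x))" for x
  proof -
    obtain u v where uv: "L x = (u, v)" by (cases "L x")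
    have z: "x + w * x ^ q = w ^ 2 * u" "x + w ^ 2 * x ^ q = w * v"
      using uv by (auto simp: L_def omega_simps algebra_simps)
    have 1: "w ^ (1 + 2 * \<alpha> + \<beta>) = w ^ 2" "w ^ (2 + \<alpha> + 2 * \<beta>) = w ^ 1"
      by (rule w_power_cong, use mod in presburger)+
    have "poly (f_A q (2 ^ i) (2 ^ j)) x = w * ((w ^ 2 * u) ^ \<alpha> * (w * v) ^ \<beta>) +
        w ^ 2 * ((w * v) ^ \<alpha> * (w ^ 2 * u) ^ \<beta>)"
      unfolding poly_f_A \<alpha>_def \<beta>_def z ..
    also have "\<dots> = w ^ (1 + 2 * \<alpha> + \<beta>) * (u ^ \<alpha> * v ^ \<beta>) + w ^ (2 + \<alpha> + 2 * \<beta>) * (u ^ \<beta> * v ^ \<alpha>)"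
      by (simp add: power_mult_distrib power_add mult_ac flip: power_mult) (simp add: power2_eq_square)
    finally show ?thesis unfolding 1 by (simp add: uv M'_def)
  qed
  then have "poly (f_A q (2 ^ i) (2 ^ j)) =
      M' \<circ> (\<lambda>(u, v). (u ^ \<alpha> * v ^ \<beta>, u ^ \<beta> * v ^ \<alpha>)) \<circ> L" by auto
  moreover have "(\<lambda>(u, v). (u ^ \<alpha> * v ^ \<beta>, u ^ \<beta> * v ^ \<alpha>)) ` (Fq q \<times> Fq q)
      \<subseteq> (Fq q \<times> Fq q :: ('a \<times> 'a) set)"
    by (auto intro!: Fq Fq_power)
  ultimately show ?thesis using L1 L2 unfolding linear_equivalent_def \<alpha>_def \<beta>_def by blast
qed

end

section \<open>From linear equivalence to the gcd criteria\<close>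

theorem theorem1p2:
  fixes m i j q Q1 Q2 :: nat
  assumes "0 < m" and "0 < i" and "0 < j"
    and "q = 2 ^ m" and "Q1 = 2 ^ i" and "Q2 = 2 ^ j"
    and "CARD('a::finite_field) = q ^ 2"
  shows
    "(bij (poly (f_A q Q1 Q2 :: 'a poly)) \<longleftrightarrow>
        (odd m \<and> odd (i * j) \<and> gcd (Q1 + Q2 + 1) (q - 1) = 1) \<or>
        (even m \<and> gcd (Q1 + Q2 + 1) (q - 1) = 1 \<and>
         gcd (int Q1 + int Q2 + 1 - 2 * int (r_A i j)) (int q + 1) = 1)) \<and>
     (odd m \<and> odd (i * j) \<and> gcd (Q1 + Q2 + 1) (q - 1) = 1 \<longrightarrow>
        linear_equivalent (poly (f_A q Q1 Q2 :: 'a poly)) (Fq q \<times> Fq q :: ('a \<times> 'a) set)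
          (\<lambda>(u, v). (u ^ (Q1 + Q2 + 1), v ^ (Q1 + Q2 + 1)))) \<and>
     (even m \<and> gcd (Q1 + Q2 + 1) (q - 1) = 1 \<and>
      gcd (int Q1 + int Q2 + 1 - 2 * int (r_A i j)) (int q + 1) = 1 \<longrightarrow>
        linear_equivalent (poly (f_A q Q1 Q2 :: 'a poly)) (UNIV :: 'a set)
          (\<lambda>x. x ^ (Q1 + Q2 + 1 + r_A i j * (q - 1))))"
proof -
  let ?f = "poly (f_A q Q1 Q2 :: 'a poly)"
  define d where "d = Q1 + Q2 + 1"
  note card = assms(7) and q = assms(4)
  have q2: "2 \<le> q" using assms(1) q by (cases m) auto
  have q_split: "q ^ 2 - 1 = (q - 1) * (q + 1)"
    using q2 by (simp add: power2_eq_square algebra_simps)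
  have unit: "x ^ (q ^ 2 - 1) = 1" if "x \<noteq> 0" for x :: 'a
  proof -
    have "x ^ (q ^ 2 - 1) * x = x"
      using finite_field_power_card_eq_same[of x] card q2 by (subst power_minus_mult) simp_all
    then show ?thesis using that by simp
  qed
  have card': "CARD('a) = Suc (q ^ 2 - 1)" using card q2 by simp
  have pos: "0 < q ^ 2 - 1" using q2 q_split by simp
  \<comment> \<open>A primitive cube root of unity exists in the field for either parity of
    \<open>m\<close>.\<close>
  have "3 dvd q ^ 2 - 1"
  proof -
    have "q ^ 2 mod 3 = 1" unfolding q power_mult[symmetric] two_power_mod_3 by simp
    then show ?thesis by presburger
  qed
  then obtain w :: 'a where "w \<noteq> 1" "w ^ 3 = 1"
    using ex_nontrivial_root_of_unity[of "UNIV :: 'a set" "q ^ 2 - 1" 3] card' unit pos by auto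
  moreover have "(w - 1) * (w * w + w + 1) = w ^ 3 - 1"
    by (simp add: algebra_simps power3_eq_cube)
  ultimately have w: "w * w + w + 1 = 0" by simp
  note even_case = linear_equivalent_f_A_even[OF assms(1) q card w, of i j, folded assms(5,6)]
  note odd_case = linear_equivalent_f_A_odd[OF assms(1) q card w, of i j, folded assms(5,6)]
  show ?thesis
  proof (cases "even m")
    case True
    define e where "e = Q1 + Q2 + 1 + r_A i j * (q - 1)"
    have "bij ?f \<longleftrightarrow> inj (\<lambda>x::'a. x ^ e)"
      using linear_equivalent_bij_iff[OF even_case[OF True]] by (simp only: e_def)
    also have "\<dots> \<longleftrightarrow> coprime e (q ^ 2 - 1)"
      by (rule inj_on_power_iff_coprime) (use card' unit pos in \<open>auto simp: e_def\<close>)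
    also have "\<dots> \<longleftrightarrow> coprime e (q - 1) \<and> coprime e (q + 1)"
      unfolding q_split by (rule coprime_mult_right_iff)
    also have "coprime e (q - 1) \<longleftrightarrow> gcd d (q - 1) = 1"
    proof -
      have e: "e = r_A i j * (q - 1) + d" by (simp add: e_def d_def)
      show ?thesis
        unfolding coprime_iff_gcd_eq_1 e gcd.commute[of _ "q - 1"] gcd_add_mult ..
    qed
    also have "coprime e (q + 1) \<longleftrightarrow> coprime (int e) (int q + 1)"
      using coprime_int_iff[of e "q + 1"] by (simp add: add.commute)
    also have "\<dots> \<longleftrightarrow> gcd (int Q1 + int Q2 + 1 - 2 * int (r_A i j)) (int q + 1) = 1"
    proof -
      \<comment> \<open>Modulo \<open>q + 1\<close> the factor \<open>q - 1\<close> is -2, which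
        produces the term \<open>- 2 * int (r_A i j)\<close>.\<close>
      have e: "int e = int (r_A i j) * (int q + 1) + (int Q1 + int Q2 + 1 - 2 * int (r_A i j))"
      proof -
        have "int (q - 1) = int q - 1" using q2 by (simp add: of_nat_diff)
        then show ?thesis
          unfolding e_def of_nat_add of_nat_mult by (simp add: algebra_simps)
      qed
      show ?thesis
        unfolding coprime_iff_gcd_eq_1 e gcd.commute[of _ "int q + 1"] gcd_add_mult ..
    qed
    finally show ?thesis using even_case[OF True] True unfolding d_def by simp
  next
    case False
    note Fq = Fq_subfield[OF assms(1) q card]
    have inj_iff: "bij ?f \<longleftrightarrow> inj_on (\<lambda>(u, v). (u ^ exp_z i j * v ^ exp_z' i j,
        u ^ exp_z' i j * v ^ exp_z i j)) (Fq q \<times> Fq q :: ('a \<times> 'a) set)"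
      by (rule linear_equivalent_bij_iff[OF odd_case[OF False]])
    show ?thesis
    proof (cases "odd (i * j)")
      case True
      then have exps: "exp_z i j = d" "exp_z' i j = 0"
        by (auto simp: exp_z_def exp_z'_def d_def assms)
      \<comment> \<open>With \<open>exp_z' i j = 0\<close> the coordinates decouple; fixing one of
        them at 0 recovers injectivity of the single power map.\<close>
      have "inj_on (\<lambda>(u, v). (u ^ d, v ^ d)) (Fq q \<times> Fq q :: ('a \<times> 'a) set) \<longleftrightarrow>
          inj_on (\<lambda>u. u ^ d) (Fq q :: 'a set)"
        using Fq(1) by (auto simp: inj_on_def)
      also have "\<dots> \<longleftrightarrow> coprime d (q - 1)"
      proof (rule inj_on_power_iff_coprime)
        show "card (Fq q :: 'a set) = Suc (q - 1)"
          using card_Fq[OF assms(1) q card] q2 by simp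
        show "x ^ (q - 1) = 1" if "x \<in> Fq q" "x \<noteq> 0" for x :: 'a
        proof -
          have "x ^ (q - 1) * x = x" using that q2
            by (metis (mono_tags, lifting) Fq_def mem_Collect_eq power_minus_mult
                less_le_trans pos2)
          then show ?thesis using that by simp
        qed
        show "x ^ k \<in> Fq q" if "x \<in> Fq q" for x :: 'a and k
          using that by (induction k) (auto intro: Fq)
      qed (use q2 Fq in \<open>auto simp: d_def\<close>)
      finally have "bij ?f \<longleftrightarrow> gcd d (q - 1) = 1"
        using inj_iff unfolding exps by (simp add: coprime_iff_gcd_eq_1)
      moreover have "linear_equivalent ?f (Fq q \<times> Fq q :: ('a \<times> 'a) set)
          (\<lambda>(u, v). (u ^ d, v ^ d))"
        using odd_case[OF False] by (simp only: exps power_0 mult_1_left mult_1_right)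
      ultimately show ?thesis using False True unfolding d_def by simp
    next
      case even: False
      have "exp_z i j \<noteq> 0" "exp_z' i j \<noteq> 0"
        using even by (auto simp: exp_z_def exp_z'_def)
      \<comment> \<open>Both exponents are positive, so (1, 0) and (0, 0) have the same image (0,
        0).\<close>
      then have "\<not> bij ?f"
        unfolding inj_iff using Fq(1,2) inj_onD[of _ "Fq q \<times> Fq q" "(1 :: 'a, 0 :: 'a)" "(0, 0)"]
        by fastforce
      then show ?thesis using even False by simp
    qed
  qed
qed

end
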